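(* Let $f\ge 1$ and let $N$ be the number of players, exactly $f$ of whom are malicious. If $N\ge 2f+1$, then the quantum Byzantine agreement protocol described in the context reaches Byzantine agreement. That is, for every choice of which $f$ players are malicious (the commanding general $S$ may be one of them) and for every admissible execution, the final outputs $m^{1,R_i}_{S}$ of the honest lieutenants satisfy both of the following conditions. (IC$_1$) All honest lieutenants have the same output: $m^{1,R_i}_S=m^{1,R_k}_S$ for all honest lieutenants $R_i,R_k$. (IC$_2$) If the commanding general $S$ is honest and multicasts the message $m$, then $m^{1,R_i}_S=m$ for every honest lieutenant $R_i$.
   Context: Players. There are $N$ players: a commanding general $S$ (the initial primary) and lieutenants $R_1,\dots,R_{N-1}$. Exactly $f\ge1$ of the $N$ players are malicious (dishonest) and the others are honest. Messages are elements of a set $\mathcal M$. Routes and multicast rounds. A route of depth $d$ ($1\le d\le f$) is a sequence $\zeta=(S\to R_{i_1}\to\dots\to R_{i_{d-1}})$ of $d$ distinct players starting with $S$. For each route $\zeta$ of depth $d$ there is a multicast round $\mathcal{MR}^d_\zeta$. Its primary is the last player of $\zeta$, and its backups are the $N-d$ players not occurring in $\zeta$. For each ordered pair of distinct backups $(j,i)$, the primary, $j$ (as forwarder) and $i$ (as verifier) run a three-party quantum digital signature (QDS): the primary signs a message and sends it to $j$, and $j$ forwards it to $i$. Each honest backup $i$ records a broadcasting list $B^{d,i}_\zeta=(r_\zeta(i,j))_j$, indexed by all backups $j$ of the round. Here $r_\zeta(i,i)$ is the message $i$ receives directly from the primary when acting as forwarder, and for $j\ne i$, $r_\zeta(i,j)$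 is the message that $i$, as verifier, accepts via forwarder $j$. Admissible executions (broadcasting phase). The QDS is treated as ideal (unforgeable and nonrepudiable as long as at most one of its three participants is dishonest, and also whenever the signer is honest). An admissible execution is any family of values $r_\zeta(i,j)\in\mathcal M$ (for all routes $\zeta$ of depth $1\le d\le f$, honest backups $i$ and backups $j$ of $\mathcal{MR}^d_\zeta$) satisfying the following. (E1) Honest primary and unforgeability: if the primary $p$ of $\mathcal{MR}^d_\zeta$ is honest, it multicasts a single message $m_\zeta$, and $r_\zeta(i,j)=m_\zeta$ for all honest backups $i$ and all backups $j$. If $d=1$, $m_\zeta$ is the message chosen by $S$. If $d\ge2$ and $\zeta=\zeta'\to p$, then $m_\zeta=r_{\zeta'}(p,p)$, the message $p$ received from the primary of the previous round. (E2) Honest forwarder: if backup $j$ is honest, then $r_\zeta(i,j)=r_\zeta(j,j)$ for all honest backups $i$. (E3) Consistency check: if $d\ge2$ and $\zeta=\zeta'\to p$, then for every honest backup $i$ of $\mathcal{MR}^d_\zeta$, the message received from the primary $p$ equals the message $p$ forwarded to $i$ at the previous depth: $r_\zeta(i,i)=r_{\zeta'}(i,p)$. (E4) All values not constrained by (E1)–(E3) are arbitrary, chosen by the dishonest players. In particular, if the primary and the forwarder $j$ are both dishonest, they may collude, and the values $r_\zeta(i,j)$ for different honest $i$ are arbitrary. A dishonest $S$ may send different messages to different honest forwarders. Gathering phase. $\mathrm{majority}(\cdot)$ takes a finite multiset of messages and returns an element occurring most often. Ties are broken by a fixed deterministic rule common to all players, so the result depends only on the multiset. Each honest lieutenant $i$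 computes gathering lists for every route $\zeta$ not containing $i$. If $\zeta$ has depth $f$, then $G^{f,i}_\zeta=B^{f,i}_\zeta$. If $\zeta$ has depth $1\le d<f$, then $G^{d,i}_\zeta$ is the list indexed by all backups $R_p$ of $\mathcal{MR}^d_\zeta$ whose entry at $p\ne i$ is $m^{d+1,i}_{\zeta\to R_p}:=\mathrm{majority}(G^{d+1,i}_{\zeta\to R_p})$ and whose entry at $p=i$ is $r_\zeta(i,i)$. The output of $i$ for the round of $\zeta$ is $m^{d,i}_\zeta=\mathrm{majority}(G^{d,i}_\zeta)$, and the final output is $m^{1,i}_S=\mathrm{majority}(G^{1,i}_S)$. *)

theory Defs
  imports "HOL-Library.Multiset"
begin

text \<open>
  Conventions: \<open>P\<close> is the set of all players, \<open>S\<close> the commanding general, \<open>D\<close> the set of dishonest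
  players. A route is the list of its players in order, starting with \<open>S\<close>; its primary is the last
  one. An execution is given by its values \<open>r \<zeta> i j\<close>, the message that \<open>i\<close> records from forwarder
  \<open>j\<close> in the round of \<open>\<zeta>\<close>; only the values for routes \<open>\<zeta>\<close>, honest backups \<open>i\<close> and backups \<open>j\<close>
  are meaningful.
\<close>

definition route :: "'p set \<Rightarrow> 'p \<Rightarrow> nat \<Rightarrow> 'p list \<Rightarrow> bool" where
  "route P S f \<zeta> \<longleftrightarrow>
     \<zeta> \<noteq> [] \<and> hd \<zeta> = S \<and> distinct \<zeta> \<and> set \<zeta> \<subseteq> P \<and> length \<zeta> \<le> f"

definition backups :: "'p set \<Rightarrow> 'p list \<Rightarrow> 'p set" where
  "backups P \<zeta> = P - set \<zeta>"

text \<open>The message multicast by an honest primary; \<open>m\<close> is the message chosen by \<open>S\<close>.\<close>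

definition primary_message ::
  "'m \<Rightarrow> ('p list \<Rightarrow> 'p \<Rightarrow> 'p \<Rightarrow> 'm) \<Rightarrow> 'p list \<Rightarrow> 'm" where
  "primary_message m r \<zeta> =
     (if length \<zeta> = 1 then m else r (butlast \<zeta>) (last \<zeta>) (last \<zeta>))"

text \<open>
  The three conjuncts are: honest primary and unforgeability; honest forwarder; consistency check
  between consecutive depths. Everything else is left to the dishonest players. If \<open>S\<close> is
  dishonest, \<open>m\<close> is irrelevant.
\<close>

definition admissible ::
  "'p set \<Rightarrow> 'p \<Rightarrow> 'p set \<Rightarrow> nat \<Rightarrow> 'm \<Rightarrow> ('p list \<Rightarrow> 'p \<Rightarrow> 'p \<Rightarrow> 'm) \<Rightarrow> bool" where
  "admissible P S D f m r \<longleftrightarrow>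
     (\<forall>\<zeta>. route P S f \<zeta> \<longrightarrow> last \<zeta> \<notin> D \<longrightarrow>
        (\<forall>i \<in> backups P \<zeta> - D. \<forall>j \<in> backups P \<zeta>. r \<zeta> i j = primary_message m r \<zeta>)) \<and>
     (\<forall>\<zeta>. route P S f \<zeta> \<longrightarrow>
        (\<forall>i \<in> backups P \<zeta> - D. \<forall>j \<in> backups P \<zeta> - D. r \<zeta> i j = r \<zeta> j j)) \<and>
     (\<forall>\<zeta> p. \<zeta> \<noteq> [] \<longrightarrow> route P S f (\<zeta> @ [p]) \<longrightarrow>
        (\<forall>i \<in> backups P (\<zeta> @ [p]) - D. r (\<zeta> @ [p]) i i = r \<zeta> i p))"

text \<open>
  Since \<open>maj\<close> is a function of the multiset, ties are broken by a fixed rule common to all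
  players.
\<close>

definition majority_rule :: "('m multiset \<Rightarrow> 'm) \<Rightarrow> bool" where
  "majority_rule maj \<longleftrightarrow>
     (\<forall>M. M \<noteq> {#} \<longrightarrow> maj M \<in># M \<and> (\<forall>x. count M x \<le> count M (maj M)))"

text \<open>A list indexed by the backups of a round is represented by a function on players.\<close>

definition list_majority ::
  "'p set \<Rightarrow> ('m multiset \<Rightarrow> 'm) \<Rightarrow> 'p list \<Rightarrow> ('p \<Rightarrow> 'm) \<Rightarrow> 'm" where
  "list_majority P maj \<zeta> L = maj (image_mset L (mset_set (backups P \<zeta>)))"

text \<open>
  \<open>gathering P f maj r i \<zeta> p\<close> is the entry at \<open>p\<close> of the gathering list of \<open>i\<close> for \<open>\<zeta>\<close>. Routes have
  length at most \<open>f\<close>, so \<open>f \<le> length \<zeta>\<close> means depth exactly \<open>f\<close>.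
\<close>

function gathering ::
  "'p set \<Rightarrow> nat \<Rightarrow> ('m multiset \<Rightarrow> 'm) \<Rightarrow> ('p list \<Rightarrow> 'p \<Rightarrow> 'p \<Rightarrow> 'm)
    \<Rightarrow> 'p \<Rightarrow> 'p list \<Rightarrow> 'p \<Rightarrow> 'm" where
  "gathering P f maj r i \<zeta> p =
     (if f \<le> length \<zeta> then r \<zeta> i p
      else if p = i then r \<zeta> i i
      else list_majority P maj (\<zeta> @ [p]) (\<lambda>q. gathering P f maj r i (\<zeta> @ [p]) q))"
  by pat_completeness auto
termination
  by (relation "measure (\<lambda>(P, f, maj, r, i, \<zeta>, p). f - length \<zeta>)") auto

declare gathering.simps [simp del]

definition round_output ::
  "'p set \<Rightarrow> nat \<Rightarrow> ('m multiset \<Rightarrow> 'm) \<Rightarrow> ('p list \<Rightarrow> 'p \<Rightarrow> 'p \<Rightarrow> 'm)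
    \<Rightarrow> 'p \<Rightarrow> 'p list \<Rightarrow> 'm" where
  "round_output P f maj r i \<zeta> = list_majority P maj \<zeta> (gathering P f maj r i \<zeta>)"

end

theory Submission
  imports Defs
begin

text \<open>
  Call a round balanced if at most half of its backups are dishonest. Two kinds of rounds have the
  output \<open>v\<close> at every honest backup: balanced rounds whose honest primary multicasts \<open>v\<close>, and
  rounds with a strict honest majority among the backups, in which the (possibly dishonest) primary
  sends \<open>v\<close> directly to all honest backups. Both are proved by one induction from the deepest rounds
  upwards: appending a dishonest player to a round of the first kind gives one of the second kind by
  the consistency check, and appending an honest player to a round of the second kind gives one of
  the first kind. The crucial case is an exactly balanced round with honest primary. There the
  subrounds of the other honest backups may fail, but the dishonest players' own subrounds yield
  \<open>v\<close>; with the direct message this is a majority.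

  If \<open>S\<close> is honest, the first kind applies to the round of \<open>S\<close>. If \<open>S\<close> is dishonest, consider
  routes of dishonest players only. At depth \<open>f\<close> all backups are honest and hence hold equal lists;
  at smaller depth, the entry of an honest \<open>p\<close> is the message that \<open>p\<close> received, by the first kind,
  and the entry of a dishonest \<open>p\<close> is common by induction.
\<close>

lemma backups_snoc: "backups P (\<zeta> @ [p]) = backups P \<zeta> - {p}"
  by (auto simp: backups_def)

lemma route_snoc:
  assumes "route P S f \<zeta>" "length \<zeta> < f" "p \<in> backups P \<zeta>"
  shows "route P S f (\<zeta> @ [p])"
  using assms by (auto simp: route_def backups_def)

text \<open>The entries outside \<open>T\<close> are fewer than those in \<open>T\<close>, so no
  \<open>x \<noteq> v\<close> can occur as often as \<open>v\<close>. The most frequent value is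
  thus unique and the tie-breaking of \<open>maj\<close> never matters.\<close>

lemma list_majority_eqI:
  assumes maj: "majority_rule maj" and fin: "finite (backups P \<zeta>)"
    and sub: "T \<subseteq> backups P \<zeta>" and val: "\<And>p. p \<in> T \<Longrightarrow> L p = v"
    and card: "card (backups P \<zeta> - T) < card T"
  shows "list_majority P maj \<zeta> L = v"
proof -
  let ?B = "backups P \<zeta>"
  let ?M = "image_mset L (mset_set ?B)"
  have count: "count ?M x = card {p \<in> ?B. L p = x}" for x
    using fin by (simp add: count_image_mset vimage_def Int_def conj_commute)
  have le: "card T \<le> count ?M v"
    unfolding count using fin sub val by (intro card_mono) auto
  moreover have "count ?M x \<le> card (?B - T)" if "x \<noteq> v" for x
    unfolding count using fin val that by (intro card_mono) auto
  moreover have "?M \<noteq> {#}"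
    using le card by (metis count_empty not_less_zero order_less_le_trans)
  ultimately show ?thesis
    using maj card unfolding majority_rule_def list_majority_def
    by (metis leD order.strict_trans1)
qed

locale protocol =
  fixes P D :: "'p set" and S :: 'p and f :: nat
    and maj :: "'m multiset \<Rightarrow> 'm" and m :: 'm
    and r :: "'p list \<Rightarrow> 'p \<Rightarrow> 'p \<Rightarrow> 'm"
  assumes finite_players: "finite P"
    and majority_rule: "majority_rule maj"
    and admissible: "admissible P S D f m r"
begin

lemma finite_backups [simp]: "finite (backups P \<zeta>)"
  using finite_players by (simp add: backups_def)

lemma honest_primary:
  assumes "route P S f \<zeta>" "last \<zeta> \<notin> D" "i \<in> backups P \<zeta> - D" "j \<in> backups P \<zeta>"
  shows "r \<zeta> i j = primary_message m r \<zeta>"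
  using admissible assms unfolding admissible_def by blast

lemma honest_forwarder:
  assumes "route P S f \<zeta>" "i \<in> backups P \<zeta> - D" "j \<in> backups P \<zeta> - D"
  shows "r \<zeta> i j = r \<zeta> j j"
  using admissible assms unfolding admissible_def by blast

lemma consistency_check:
  assumes "route P S f \<zeta>" "route P S f (\<zeta> @ [p])" "i \<in> backups P (\<zeta> @ [p]) - D"
  shows "r (\<zeta> @ [p]) i i = r \<zeta> i p"
  using admissible assms unfolding admissible_def route_def by blast

lemma honest_primary_snoc:
  assumes "route P S f (\<zeta> @ [p])" "\<zeta> \<noteq> []" "p \<notin> D"
    and "i \<in> backups P (\<zeta> @ [p]) - D" "j \<in> backups P (\<zeta> @ [p])"
  shows "r (\<zeta> @ [p]) i j = r \<zeta> p p"
  using honest_primary[of "\<zeta> @ [p]" i j] assms by (simp add: primary_message_def)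

lemma gathering_deepest: "f \<le> length \<zeta> \<Longrightarrow> gathering P f maj r i \<zeta> p = r \<zeta> i p"
  by (simp add: gathering.simps)

lemma gathering_self: "gathering P f maj r i \<zeta> i = r \<zeta> i i"
  by (simp add: gathering.simps)

lemma gathering_subround:
  "length \<zeta> < f \<Longrightarrow> p \<noteq> i \<Longrightarrow> gathering P f maj r i \<zeta> p = round_output P f maj r i (\<zeta> @ [p])"
  by (subst gathering.simps) (simp add: round_output_def)

lemma round_output_eqI:
  assumes "T \<subseteq> backups P \<zeta>" "\<And>p. p \<in> T \<Longrightarrow> gathering P f maj r i \<zeta> p = v"
    and "card (backups P \<zeta> - T) < card T"
  shows "round_output P f maj r i \<zeta> = v"
  unfolding round_output_def
  using assms by (intro list_majority_eqI[OF majority_rule finite_backups])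

text \<open>The first alternative speaks of recorded values, not of an honest primary. So
  \<open>v\<close> can stay fixed through the induction, although \<open>primary_message m r\<close>
  depends on the route.\<close>

lemma round_output_common_value:
  assumes "route P S f \<zeta>"
  shows "(\<forall>i \<in> backups P \<zeta> - D. \<forall>j \<in> backups P \<zeta>. r \<zeta> i j = v) \<and>
           card (backups P \<zeta> \<inter> D) \<le> card (backups P \<zeta> - D) \<or>
         (\<forall>i \<in> backups P \<zeta> - D. r \<zeta> i i = v) \<and>
           card (backups P \<zeta> \<inter> D) < card (backups P \<zeta> - D) \<Longrightarrow>
         i \<in> backups P \<zeta> - D \<Longrightarrow> round_output P f maj r i \<zeta> = v"
  using assms
proof (induction "f - length \<zeta>" arbitrary: \<zeta> i rule: less_induct)
  case less
  let ?B = "backups P \<zeta>"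
  note route = \<open>route P S f \<zeta>\<close> and i = \<open>i \<in> ?B - D\<close>
  have direct: "r \<zeta> j j = v" if "j \<in> ?B - D" for j
    using less.prems(1) that by blast
  have self: "gathering P f maj r i \<zeta> i = v"
    using direct i by (simp add: gathering_self)
  have honest: "gathering P f maj r i \<zeta> p = v"
    if p: "p \<in> ?B - D" and lt: "card (?B \<inter> D) < card (?B - D)" for p
  proof (cases "f \<le> length \<zeta> \<or> p = i")
    case True
    then show ?thesis
      using self honest_forwarder[OF route i p] direct[OF p] by (auto simp: gathering_deepest)
  next
    case False
    have route': "route P S f (\<zeta> @ [p])"
      using route_snoc[OF route] False p by auto
    have "r (\<zeta> @ [p]) k j = v" if "k \<in> backups P (\<zeta> @ [p]) - D" "j \<in> backups P (\<zeta> @ [p])" for k j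
      using honest_primary_snoc[OF route' _ _ that] route direct[OF p] p by (auto simp: route_def)
    \<comment> \<open>Removing the honest \<open>p\<close> costs one honest backup, so a strict
      honest majority leaves a balanced round.\<close>
    moreover have "card ((?B - {p}) \<inter> D) \<le> card (?B - {p} - D)"
    proof -
      have "(?B - {p}) \<inter> D = ?B \<inter> D" "?B - {p} - D = ?B - D - {p}"
        using p by auto
      then show ?thesis using p lt by simp
    qed
    moreover have "length \<zeta> < f" "p \<noteq> i"
      using False by auto
    ultimately show ?thesis
      using i route' less.hyps[of "\<zeta> @ [p]" i]
      by (simp add: backups_snoc gathering_subround)
  qed
  show ?case
  \<comment> \<open>The split is on strictness, not on the two alternatives: both give
    \<open>direct\<close>, which is all that the strict case needs.\<close>
  proof (cases "card (?B \<inter> D) < card (?B - D)")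
    case True
    then have "card (?B - (?B - D)) < card (?B - D)"
      by (simp add: double_diff Diff_Diff_Int)
    then show ?thesis
      using honest True by (intro round_output_eqI[where T = "?B - D"]) auto
  next
    case False
    then have all: "\<And>i j. i \<in> ?B - D \<Longrightarrow> j \<in> ?B \<Longrightarrow> r \<zeta> i j = v"
      and eq: "card (?B \<inter> D) = card (?B - D)"
      using less.prems(1) by auto
    have dishonest: "gathering P f maj r i \<zeta> p = v" if p: "p \<in> ?B \<inter> D" for p
    proof (cases "f \<le> length \<zeta>")
      case True
      then show ?thesis using all i p by (simp add: gathering_deepest)
    next
      case False
      have route': "route P S f (\<zeta> @ [p])"
        using route_snoc[OF route] False p by auto
      have "r (\<zeta> @ [p]) k k = v" if "k \<in> backups P (\<zeta> @ [p]) - D" for k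
        using consistency_check[OF route route' that] all that p by (simp add: backups_snoc)
      moreover have "card ((?B - {p}) \<inter> D) < card (?B - {p} - D)"
      proof -
        have "(?B - {p}) \<inter> D = ?B \<inter> D - {p}" "?B - {p} - D = ?B - D"
          using p by auto
        moreover have "card (?B \<inter> D - {p}) < card (?B \<inter> D)"
          using p by (intro card_Diff1_less) auto
        ultimately show ?thesis using eq by simp
      qed
      moreover have "p \<noteq> i" using p i by auto
      ultimately show ?thesis
        using False i route' less.hyps[of "\<zeta> @ [p]" i]
        by (simp add: backups_snoc gathering_subround)
    qed
    \<comment> \<open>The dishonest entries are exactly half of the list; the direct message of
      \<open>i\<close> tips the balance.\<close>
    have "?B - insert i (?B \<inter> D) = ?B - D - {i}" by auto
    then have "card (?B - insert i (?B \<inter> D)) < card (?B - D)"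
      using i by (simp only:) (intro card_Diff1_less, auto)
    moreover have "card (insert i (?B \<inter> D)) = Suc (card (?B \<inter> D))"
      using i by simp
    ultimately show ?thesis
      using eq i self dishonest by (intro round_output_eqI[where T = "insert i (?B \<inter> D)"]) auto
  qed
qed

lemma round_output_honest_primary:
  assumes "route P S f \<zeta>" "last \<zeta> \<notin> D" "i \<in> backups P \<zeta> - D"
    and "card (backups P \<zeta> \<inter> D) \<le> card (backups P \<zeta> - D)"
  shows "round_output P f maj r i \<zeta> = primary_message m r \<zeta>"
proof (rule round_output_common_value[OF assms(1) disjI1 assms(3)])
  show "(\<forall>i \<in> backups P \<zeta> - D. \<forall>j \<in> backups P \<zeta>. r \<zeta> i j = primary_message m r \<zeta>) \<and>
      card (backups P \<zeta> \<inter> D) \<le> card (backups P \<zeta> - D)"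
    using assms(4) honest_primary[OF assms(1,2)] by blast
qed

text \<open>Since the route has used up only dishonest players, all honest players, at least
  \<open>f + 1\<close> of them, are still backups.\<close>

lemma round_output_agreement:
  assumes D: "D \<subseteq> P" "card D = f" "2 * f < card P"
    and "route P S f \<zeta>" "set \<zeta> \<subseteq> D" "i \<in> backups P \<zeta> - D" "k \<in> backups P \<zeta> - D"
  shows "round_output P f maj r i \<zeta> = round_output P f maj r k \<zeta>"
  using assms(4-)
proof (induction "f - length \<zeta>" arbitrary: \<zeta> rule: less_induct)
  case less
  let ?B = "backups P \<zeta>"
  note route = \<open>route P S f \<zeta>\<close> and sub = \<open>set \<zeta> \<subseteq> D\<close>
  have finD: "finite D" using D finite_players finite_subset by blast
  have "gathering P f maj r i \<zeta> p = gathering P f maj r k \<zeta> p" if p: "p \<in> ?B" for p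
  proof (cases "p \<in> D")
    case honest: False
    \<comment> \<open>The right-hand side does not mention \<open>j\<close>, which makes the entries
      of \<open>i\<close> and \<open>k\<close> equal.\<close>
    have "gathering P f maj r j \<zeta> p = r \<zeta> p p" if j: "j \<in> ?B - D" for j
    proof (cases "f \<le> length \<zeta> \<or> p = j")
      case True
      then show ?thesis
        using honest_forwarder[OF route j, of p] p honest
        by (auto simp: gathering_deepest gathering_self)
    next
      case False
      have route': "route P S f (\<zeta> @ [p])"
        using route_snoc[OF route] False p by auto
      have "card (P - D) = card P - f"
        using D finD by (simp add: card_Diff_subset)
      moreover have "card (P - D - {p}) = card (P - D) - 1"
        using p honest by (simp add: backups_def)
      moreover have "backups P (\<zeta> @ [p]) - D = P - D - {p}"
        using sub by (auto simp: backups_def)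
      moreover have "card (backups P (\<zeta> @ [p]) \<inter> D) \<le> f"
        using D finD by (metis card_mono inf_le2)
      ultimately have "card (backups P (\<zeta> @ [p]) \<inter> D) \<le> card (backups P (\<zeta> @ [p]) - D)"
        using D by simp
      then have "round_output P f maj r j (\<zeta> @ [p]) = primary_message m r (\<zeta> @ [p])"
        using False j honest route'
        by (intro round_output_honest_primary) (auto simp: backups_snoc)
      then show ?thesis
        using False route by (simp add: gathering_subround primary_message_def route_def)
    qed
    then show ?thesis using less.prems by simp
  next
    case dishonest: True
    \<comment> \<open>The dishonest \<open>p\<close> is not on the route, so the route misses an
      element of \<open>D\<close>; at depth \<open>f\<close> no dishonest backup remains.\<close>
    have "length \<zeta> < f"
    proof -
      have "card (set \<zeta>) < card D"
        using sub dishonest p finD by (intro psubset_card_mono) (auto simp: backups_def)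
      then show ?thesis using D route by (simp add: route_def distinct_card)
    qed
    moreover have "round_output P f maj r i (\<zeta> @ [p]) = round_output P f maj r k (\<zeta> @ [p])"
      using calculation less.prems p dishonest
      by (intro less.hyps) (auto simp: backups_snoc route_snoc)
    moreover have "p \<noteq> i" "p \<noteq> k"
      using dishonest less.prems by auto
    ultimately show ?thesis by (simp add: gathering_subround)
  qed
  then show ?case
    unfolding round_output_def list_majority_def
    by (intro arg_cong[where f = maj] image_mset_cong) simp
qed

end

theorem theorem1:
  fixes P D :: "'p set" and S :: 'p and N f :: nat
    and maj :: "'m multiset \<Rightarrow> 'm" and m :: 'm
    and r :: "'p list \<Rightarrow> 'p \<Rightarrow> 'p \<Rightarrow> 'm"
  assumes "finite P" and "card P = N" and "S \<in> P"
    and "D \<subseteq> P" and "card D = f"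
    and "f \<ge> 1" and "N \<ge> 2 * f + 1"
    and "majority_rule maj"
    and "admissible P S D f m r"
  shows "(\<forall>i \<in> P - {S} - D. \<forall>k \<in> P - {S} - D.
            round_output P f maj r i [S] = round_output P f maj r k [S]) \<and>
         (S \<notin> D \<longrightarrow> (\<forall>i \<in> P - {S} - D. round_output P f maj r i [S] = m))"
proof -
  interpret protocol P D S f maj m r
    using assms by unfold_locales
  have route: "route P S f [S]"
    using assms by (simp add: route_def)
  have backups: "backups P [S] = P - {S}"
    by (simp add: backups_def)
  show ?thesis
  proof (cases "S \<in> D")
    case True
    have "round_output P f maj r i [S] = round_output P f maj r k [S]"
      if "i \<in> P - {S} - D" "k \<in> P - {S} - D" for i k
      using assms True that backups by (intro round_output_agreement[OF _ _ _ route]) auto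
    then show ?thesis using True by blast
  next
    case False
    have "finite D" using assms finite_subset by blast
    then have "card (P - D) = N - f"
      using assms by (simp add: card_Diff_subset)
    moreover have "P - {S} - D = P - D - {S}" "(P - {S}) \<inter> D = D"
      using assms False by auto
    moreover have "card (P - D - {S}) = card (P - D) - 1"
      using assms False by simp
    \<comment> \<open>At least \<open>N - f - 1 \<ge> f\<close> lieutenants are honest. For
      \<open>N = 2 * f + 1\<close> this is an equality, the exactly balanced case.\<close>
    ultimately have "card (backups P [S] \<inter> D) \<le> card (backups P [S] - D)"
      using assms backups by simp
    then have "round_output P f maj r i [S] = m" if "i \<in> P - {S} - D" for i
      using round_output_honest_primary[OF route, of i] that False backups
      by (simp add: primary_message_def)
    then show ?thesis by simp
  qed
qed

end
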